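(* Consider the family of discrete-time single server queues parametrized by $\epsilon\in(0,\mu)$ described in the context. For each $\epsilon\in(0,\mu)$ let $\overline{q}^{(\epsilon)}$ be a steady-state random variable such that $\{q^{(\epsilon)}(k):k\ge 1\}$ converges in distribution to $\overline{q}^{(\epsilon)}$ as $k\uparrow\infty$. Assume further that $\lim_{\epsilon\downarrow 0}\sigma_a^{(\epsilon)}=\sigma_a$. Then $\epsilon\,\overline{q}^{(\epsilon)}$ converges in distribution, as $\epsilon\downarrow 0$, to an exponential random variable with mean $\frac{\sigma_a^2+\sigma_s^2}{2}$.
   Context: Single server queue in discrete time. For each $\epsilon\in(0,\mu)$, $q^{(\epsilon)}(k)$ is the number of jobs in the queue at the beginning of time slot $k\ge1$, $a^{(\epsilon)}(k)$ is the number of arrivals in slot $k$ and $s(k)$ is the potential number of jobs that can be served in slot $k$. The sequences $\{a^{(\epsilon)}(k):k\ge1\}$ and $\{s(k):k\ge 1\}$ are independent sequences of i.i.d. nonnegative integer-valued random variables (independent of the current queue length), bounded with probability 1 by finite constants $A_{\max}$ and $S_{\max}$ respectively (not depending on $\epsilon$). The dynamics are $$q^{(\epsilon)}(k+1)=\max\{q^{(\epsilon)}(k)+a^{(\epsilon)}(k)-s(k),0\}.$$ The service process is fixed (does not depend on $\epsilon$), with $\mu=E[s(1)]$ and $\sigma_s^2=\mathrm{Var}[s(1)]$; the arrival process satisfies $E[a^{(\epsilon)}(1)]=\mu-\epsilon$ and $\mathrm{Var}[a^{(\epsilon)}(1)]=(\sigma_a^{(\epsilon)})^2$. *)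

theory Defs
  imports "HOL-Probability.Probability"
begin

text \<open>
  The library's \<^const>\<open>weak_conv_m\<close> covers sequences of laws; families indexed by a real parameter
  need the same notion along an arbitrary filter.
\<close>

definition weak_conv_along :: "'i filter \<Rightarrow> ('i \<Rightarrow> real measure) \<Rightarrow> real measure \<Rightarrow> bool" where
  "weak_conv_along F Q L \<longleftrightarrow>
     (\<forall>x. isCont (cdf L) x \<longrightarrow> ((\<lambda>i. cdf (Q i) x) \<longlongrightarrow> cdf L x) F)"

lemma weak_conv_along_sequentially: "weak_conv_along sequentially Q L \<longleftrightarrow> weak_conv_m Q L"
  by (simp add: weak_conv_along_def weak_conv_m_def weak_conv_def)

text \<open>
  The library parametrizes exponential laws by their rate. Mean \<open>0\<close> is read as the degenerate law
  at \<open>0\<close>; without this convention the formula would give the null measure, as \<open>1 / 0 = 0\<close>.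
\<close>

definition exponential_law :: "real \<Rightarrow> real measure" where
  "exponential_law m =
     (if m = 0 then return borel 0 else density lborel (exponential_density (1 / m)))"

lemma (in prob_space) exponential_law_mean:
  assumes "0 < m" "distributed M lborel X (exponential_density (1 / m))"
  shows "distr M lborel X = exponential_law m" "expectation X = m"
  using assms exponential_distributed_expectation[of "1 / m" X]
  by (auto simp: exponential_law_def distributed_distr_eq_density)

text \<open>
  Time slots are \<open>k = 1, 2, \<dots>\<close>; values at index \<open>0\<close> are unconstrained.
  In \<open>indep_current\<close> the list only serves to index the three variables \<open>q k\<close>, \<open>a k\<close>, \<open>s k\<close>. Since
  \<open>a k\<close> and \<open>s k\<close> are independent anyway, it says that \<open>q k\<close> is independent of the pair
  \<open>(a k, s k)\<close>; it holds in particular whenever \<open>q 1\<close> is independent of both sequences.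
\<close>

locale single_server_queue = prob_space M for M :: "'a measure" +
  fixes a s q :: "nat \<Rightarrow> 'a \<Rightarrow> nat" and Amax Smax :: real
  assumes indep_arrivals: "indep_vars (\<lambda>_. count_space UNIV) a {1..}"
    and ident_arrivals: "\<And>k. 1 \<le> k \<Longrightarrow>
      distr M (count_space UNIV) (a k) = distr M (count_space UNIV) (a 1)"
    and indep_services: "indep_vars (\<lambda>_. count_space UNIV) s {1..}"
    and ident_services: "\<And>k. 1 \<le> k \<Longrightarrow>
      distr M (count_space UNIV) (s k) = distr M (count_space UNIV) (s 1)"
    and indep_arrivals_services:
      "indep_var (\<Pi>\<^sub>M k\<in>{1..}. count_space UNIV) (\<lambda>\<omega>. \<lambda>k\<in>{1..}. a k \<omega>)
                 (\<Pi>\<^sub>M k\<in>{1..}. count_space UNIV) (\<lambda>\<omega>. \<lambda>k\<in>{1..}. s k \<omega>)"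
    and indep_current: "\<And>k. 1 \<le> k \<Longrightarrow>
      indep_vars (\<lambda>_. count_space UNIV) (\<lambda>i. [q k, a k, s k] ! i) {..<3}"
    and bounded_arrivals: "\<And>k. 1 \<le> k \<Longrightarrow> AE \<omega> in M. real (a k \<omega>) \<le> Amax"
    and bounded_services: "\<And>k. 1 \<le> k \<Longrightarrow> AE \<omega> in M. real (s k \<omega>) \<le> Smax"
    and dynamics: "\<And>k \<omega>. 1 \<le> k \<Longrightarrow> \<omega> \<in> space M \<Longrightarrow>
      int (q (k + 1) \<omega>) = max (int (q k \<omega>) + int (a k \<omega>) - int (s k \<omega>)) 0"

end

theory Submission
  imports Defs
begin

text \<open>
  The proof computes the limit of the characteristic function \<open>\<phi>\<close> of the steady state at \<open>\<epsilon> t\<close>.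

  Let \<open>x\<close> be arrivals minus services in one slot, with characteristic function \<open>\<psi>\<close>, and let \<open>u\<close> be the
  unused service, so that the next queue length is \<open>q + x + u\<close>. Service is wasted only when the queue
  becomes empty. Hence \<open>exp (\<i> \<theta> (q + x + u)) + exp (- \<i> \<theta> u) = exp (\<i> \<theta> (q + x)) + 1\<close>, and
  in the steady state \<open>\<phi>(\<theta>) (\<psi>(\<theta>) - 1) = E exp (- \<i> \<theta> u) - 1\<close>. Letting \<open>\<theta>\<close> tend to \<open>0\<close> gives
  \<open>E u = - E x = \<epsilon>\<close>; as \<open>u\<close> is bounded, the second moment of \<open>u\<close> is also of order \<open>\<epsilon>\<close>. So
  \<open>\<phi>(\<theta>) (\<psi>(\<theta>) - 1) = - \<i> \<theta> \<epsilon> + O(\<theta>\<^sup>2 \<epsilon>)\<close>, which is the content of \<open>stationary_estimate\<close>; it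
  is derived from \<open>one_step_estimate\<close> by a limit in time.

  With \<open>\<theta> = \<epsilon> t\<close> the right-hand side is \<open>- \<i> t \<epsilon>\<^sup>2 + O(\<epsilon>\<^sup>3)\<close>. By \<open>increment_char_expansion\<close>,
  \<open>\<psi>(\<epsilon> t) - 1 = - \<i> t \<epsilon>\<^sup>2 - t\<^sup>2 \<epsilon>\<^sup>2 E x\<^sup>2 / 2 + O(\<epsilon>\<^sup>3)\<close>, where \<open>E x\<^sup>2\<close> tends to
  \<open>\<sigma>\<^sub>a\<^sup>2 + \<sigma>\<^sub>s\<^sup>2\<close>. The quotient tends to \<open>1 / (1 - \<i> t (\<sigma>\<^sub>a\<^sup>2 + \<sigma>\<^sub>s\<^sup>2) / 2)\<close>, the
  characteristic function of the exponential law (\<open>char_exponential_law\<close>), and Levy's continuity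
  theorem gives convergence in distribution.
\<close>

section \<open>Characteristic functions: the exponential law, expansions, and continuity\<close>

lemma real_distribution_exponential_law:
  assumes "0 \<le> m"
  shows "real_distribution (exponential_law m)"
proof (cases "m = 0")
  case True
  then show ?thesis
    by (auto simp: exponential_law_def real_distribution_def real_distribution_axioms_def
             intro!: prob_space_return)
next
  case False
  then show ?thesis
    using assms prob_space_exponential_density[of "1 / m"]
    by (simp add: exponential_law_def real_distribution_def real_distribution_axioms_def)
qed

text \<open>
  For \<open>m > 0\<close> the integrand is \<open>exp (c x) / m\<close> on the half line with \<open>c = \<i> t - 1 / m\<close>, whose real
  part is negative, so the primitive \<open>exp (c x) / (c m)\<close> vanishes at infinity. The formula
  remains correct for \<open>m = 0\<close>, where both sides are \<open>1\<close>; thus vanishing limit variances require no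
  separate treatment later.
\<close>

lemma char_exponential_law:
  assumes "0 \<le> m"
  shows "char (exponential_law m) t = 1 / (1 - \<i> * t * m)"
proof (cases "m = 0")
  case True
  then show ?thesis
    by (simp add: exponential_law_def char_def integral_return)
next
  case False
  with assms have m: "0 < m" by simp
  define c where "c = \<i> * t - 1 / m"
  have c: "c \<noteq> 0" "Re c < 0"
    using m by (auto simp: c_def complex_eq_iff)
  define f where "f x = exp (c * complex_of_real x) / m" for x :: real
  define F where "F x = exp (c * complex_of_real x) / (c * m)" for x :: real
  let ?d = "exponential_density (1 / m)"
  have dens: "?d x *\<^sub>R iexp (t * x) = indicator {0..} x *\<^sub>R f x" for x
    by (auto simp: f_def c_def exponential_density_def scaleR_conv_of_real exp_of_real[symmetric]
        exp_add[symmetric] algebra_simps split: split_indicator)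
  interpret prob_space "density lborel ?d"
    using m by (intro prob_space_exponential_density) simp
  have "integrable (density lborel ?d) (\<lambda>x. iexp (t * x))"
    using integrable_iexp[of "\<lambda>x. complex_of_real (t * x)"] by simp
  then have int: "integrable lborel (\<lambda>x. indicator {0..} x *\<^sub>R f x)"
    using m by (subst (asm) integrable_density) (simp_all add: exponential_density_nonneg flip: dens)
  have int': "set_integrable lborel {0<..} f"
    unfolding set_integrable_def
  proof (subst integrable_cong_AE)
    show "AE x in lborel. indicator {0<..} x *\<^sub>R f x = indicator {0..} x *\<^sub>R f x"
      using AE_lborel_singleton[of 0] by eventually_elim (auto split: split_indicator)
  qed (use int in \<open>auto simp: f_def\<close>)
  have "char (exponential_law m) t = (CLINT x|lborel. ?d x *\<^sub>R iexp (t * x))"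
    using m by (auto simp: exponential_law_def char_def exponential_density_nonneg
        intro!: integral_density)
  also have "\<dots> = (CLINT x|lborel. indicator {0..} x *\<^sub>R f x)"
    by (simp only: dens)
  also have "\<dots> = (CLINT x|lborel. indicator {0<..} x *\<^sub>R f x)"
  proof (rule integral_cong_AE)
    show "AE x in lborel. indicator {0..} x *\<^sub>R f x = indicator {0<..} x *\<^sub>R f x"
      using AE_lborel_singleton[of 0] by eventually_elim (auto split: split_indicator)
  qed (auto simp: f_def)
  also have "\<dots> = (CLBINT x=0..\<infinity>. f x)"
    by (simp add: interval_lebesgue_integral_0_infty set_lebesgue_integral_def)
  also have "\<dots> = 0 - F 0"
  proof (rule interval_integral_FTC_integrable)
    show "(F has_vector_derivative f x) (at x)" for x
      unfolding F_def f_def using c m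
      by (auto intro!: derivative_eq_intros has_vector_derivative_real_field simp: field_simps)
    show "isCont f x" for x
      unfolding f_def using m by (intro continuous_intros) auto
    show "set_integrable lborel (einterval 0 \<infinity>) f"
      using int' by (simp add: zero_ereal_def)
    have "isCont F 0"
      unfolding F_def using c m by (intro continuous_intros) auto
    then show "((F \<circ> real_of_ereal) \<longlongrightarrow> F 0) (at_right 0)"
      by (auto simp: zero_ereal_def ereal_tendsto_simps isCont_def intro: tendsto_within_subset)
    have "((\<lambda>x. exp (Re c * x) / (cmod c * m)) \<longlongrightarrow> 0) at_top"
      using c by (intro tendsto_divide_zero filterlim_compose[OF exp_at_bot]
          filterlim_tendsto_neg_mult_at_bot[OF tendsto_const _ filterlim_ident])
    then have "(F \<longlongrightarrow> 0) at_top"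
      using m by (intro tendsto_norm_zero_cancel[of F])
         (simp add: F_def norm_divide norm_mult)
    then show "((F \<circ> real_of_ereal) \<longlongrightarrow> 0) (at_left \<infinity>)"
      by (simp add: ereal_tendsto_simps)
  qed simp
  also have "\<dots> = 1 / (1 - \<i> * t * m)"
    using m c by (simp add: F_def c_def field_simps)
  finally show ?thesis .
qed

text \<open>
  The Taylor bound for the imaginary exponential, integrated. The remainder carries the absolute
  moment of order \<open>n + 1\<close> itself, not just a power of \<open>B\<close>: for the unused service, the second
  moment is small because the first one is.
\<close>

lemma (in prob_space) iexp_expansion:
  fixes X :: "'a \<Rightarrow> real"
  assumes X [measurable]: "random_variable borel X" and B: "AE \<omega> in M. \<bar>X \<omega>\<bar> \<le> B"
  shows "cmod (expectation (\<lambda>\<omega>. iexp (\<theta> * X \<omega>))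
           - (\<Sum>k\<le>n. (\<i> * \<theta>) ^ k / fact k * expectation (\<lambda>\<omega>. X \<omega> ^ k)))
         \<le> \<bar>\<theta>\<bar> ^ Suc n / fact (Suc n) * expectation (\<lambda>\<omega>. \<bar>X \<omega>\<bar> ^ Suc n)"
proof -
  have pow: "integrable M (\<lambda>\<omega>. X \<omega> ^ k)" for k
  proof (rule integrable_const_bound)
    show "AE \<omega> in M. norm (X \<omega> ^ k) \<le> B ^ k"
      using B by eventually_elim (simp add: power_abs power_mono)
  qed simp
  have abs_pow: "integrable M (\<lambda>\<omega>. \<bar>X \<omega>\<bar> ^ k)" for k
    using integrable_abs[OF pow[of k]] by (simp add: power_abs)
  have cpow: "integrable M (\<lambda>\<omega>. (\<i> * \<theta>) ^ k / fact k * complex_of_real (X \<omega> ^ k))" for k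
    using pow[of k] by (intro integrable_mult_right integrable_of_real)
  have int: "integrable M (\<lambda>\<omega>. iexp (\<theta> * X \<omega>))"
    using integrable_iexp[of "\<lambda>\<omega>. complex_of_real (\<theta> * X \<omega>)"] by simp
  have "expectation (\<lambda>\<omega>. iexp (\<theta> * X \<omega>))
           - (\<Sum>k\<le>n. (\<i> * \<theta>) ^ k / fact k * expectation (\<lambda>\<omega>. X \<omega> ^ k))
        = expectation (\<lambda>\<omega>. iexp (\<theta> * X \<omega>) - (\<Sum>k\<le>n. (\<i> * \<theta>) ^ k / fact k * of_real (X \<omega> ^ k)))"
    using int cpow by (simp del: of_real_power)
  also have "cmod \<dots> \<le> expectation (\<lambda>\<omega>. cmod (iexp (\<theta> * X \<omega>)
                - (\<Sum>k\<le>n. (\<i> * \<theta>) ^ k / fact k * of_real (X \<omega> ^ k))))"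
    by (rule integral_norm_bound)
  also have "\<dots> \<le> expectation (\<lambda>\<omega>. \<bar>\<theta>\<bar> ^ Suc n / fact (Suc n) * \<bar>X \<omega>\<bar> ^ Suc n)"
  proof (rule integral_mono)
    fix \<omega>
    have "(\<Sum>k\<le>n. (\<i> * \<theta>) ^ k / fact k * of_real (X \<omega> ^ k))
          = (\<Sum>k\<le>n. (\<i> * (\<theta> * X \<omega>)) ^ k / fact k)"
      by (simp add: power_mult_distrib mult.assoc)
    then show "cmod (iexp (\<theta> * X \<omega>) - (\<Sum>k\<le>n. (\<i> * \<theta>) ^ k / fact k * of_real (X \<omega> ^ k)))
          \<le> \<bar>\<theta>\<bar> ^ Suc n / fact (Suc n) * \<bar>X \<omega>\<bar> ^ Suc n"
      using iexp_approx1[of "\<theta> * X \<omega>" n] by (simp add: abs_mult power_mult_distrib ac_simps)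
  next
    show "integrable M (\<lambda>\<omega>. cmod (iexp (\<theta> * X \<omega>)
                - (\<Sum>k\<le>n. (\<i> * \<theta>) ^ k / fact k * of_real (X \<omega> ^ k))))"
      by (intro integrable_norm Bochner_Integration.integrable_diff int
            Bochner_Integration.integrable_sum cpow)
    show "integrable M (\<lambda>\<omega>. \<bar>\<theta>\<bar> ^ Suc n / fact (Suc n) * \<bar>X \<omega>\<bar> ^ Suc n)"
      by (intro integrable_mult_right abs_pow)
  qed
  finally show ?thesis
    by simp
qed

text \<open>
  A one-sided limit at \<open>b\<close> can be tested on decreasing sequences, and along a sequence this is
  Levy's continuity theorem.
\<close>

lemma weak_conv_along_at_right_if_char:
  fixes P :: "real \<Rightarrow> real measure"
  assumes "b < c" and P: "\<And>\<epsilon>. \<epsilon> \<in> {b<..<c} \<Longrightarrow> real_distribution (P \<epsilon>)" and L: "real_distribution L"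
    and char: "\<And>t. ((\<lambda>\<epsilon>. char (P \<epsilon>) t) \<longlongrightarrow> char L t) (at_right b)"
  shows "weak_conv_along (at_right b) P L"
  unfolding weak_conv_along_def
proof (intro allI impI)
  fix x assume x: "isCont (cdf L) x"
  show "((\<lambda>\<epsilon>. cdf (P \<epsilon>) x) \<longlongrightarrow> cdf L x) (at_right b)"
  proof (rule tendsto_at_right_sequentially[OF \<open>b < c\<close>])
    fix e :: "nat \<Rightarrow> real"
    assume e: "\<And>n. b < e n" "\<And>n. e n < c" "e \<longlonglongrightarrow> b"
    then have "filterlim e (at_right b) sequentially"
      by (auto simp: filterlim_at intro!: always_eventually dest: less_imp_neq[of b, symmetric])
    then have "(\<lambda>n. char (P (e n)) t) \<longlonglongrightarrow> char L t" for t
      by (rule filterlim_compose[OF char])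
    then have "weak_conv_m (\<lambda>n. P (e n)) L"
      by (intro levy_continuity L P) (use e in auto)
    with x show "(\<lambda>n. cdf (P (e n)) x) \<longlonglongrightarrow> cdf L x"
      by (simp add: weak_conv_m_def weak_conv_def)
  qed
qed

section \<open>One time slot of the queue\<close>

context single_server_queue
begin

lemma measurable_queue:
  assumes "1 \<le> k"
  shows "random_variable (count_space UNIV) (q k)"
    and "random_variable (count_space UNIV) (a k)"
    and "random_variable (count_space UNIV) (s k)"
  using indep_current[OF assms] by (auto simp: indep_vars_def lessThan_Suc numeral_3_eq_3)

text \<open>
  Taking \<open>f\<close> constant also gives the product rule for arrivals and services alone.
\<close>

lemma expectation_independent_product:
  fixes f g h :: "nat \<Rightarrow> 'c::{real_normed_field, banach, second_countable_topology}"
  assumes "1 \<le> k"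
    and int: "integrable M (\<lambda>\<omega>. f (q k \<omega>))" "integrable M (\<lambda>\<omega>. g (a k \<omega>))"
      "integrable M (\<lambda>\<omega>. h (s k \<omega>))"
  shows "expectation (\<lambda>\<omega>. f (q k \<omega>) * g (a k \<omega>) * h (s k \<omega>))
    = expectation (\<lambda>\<omega>. f (q k \<omega>)) * expectation (\<lambda>\<omega>. g (a k \<omega>)) * expectation (\<lambda>\<omega>. h (s k \<omega>))"
proof -
  have "indep_vars (\<lambda>_. borel) (\<lambda>i \<omega>. ([f, g, h] ! i) (([q k, a k, s k] ! i) \<omega>)) {..<3}"
    by (rule indep_vars_compose2[OF indep_current[OF assms(1)]]) auto
  moreover have "integrable M (\<lambda>\<omega>. ([f, g, h] ! i) (([q k, a k, s k] ! i) \<omega>))" if "i \<in> {..<3}" for i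
    using that int by (auto simp: numeral_3_eq_3 less_Suc_eq)
  ultimately show ?thesis
    using indep_vars_lebesgue_integral[of "{..<3}" "\<lambda>i \<omega>. ([f, g, h] ! i) (([q k, a k, s k] ! i) \<omega>)"]
    by (simp add: numeral_3_eq_3 lessThan_Suc ac_simps)
qed

lemma expectation_arrivals:
  fixes g :: "nat \<Rightarrow> 'c::{banach, second_countable_topology}"
  assumes "1 \<le> k"
  shows "expectation (\<lambda>\<omega>. g (a k \<omega>)) = expectation (\<lambda>\<omega>. g (a 1 \<omega>))"
  using integral_distr[OF measurable_queue(2)[OF assms], of g]
    integral_distr[OF measurable_queue(2)[OF order_refl], of g] ident_arrivals[OF assms]
  by simp

lemma expectation_services:
  fixes g :: "nat \<Rightarrow> 'c::{banach, second_countable_topology}"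
  assumes "1 \<le> k"
  shows "expectation (\<lambda>\<omega>. g (s k \<omega>)) = expectation (\<lambda>\<omega>. g (s 1 \<omega>))"
  using integral_distr[OF measurable_queue(3)[OF assms], of g]
    integral_distr[OF measurable_queue(3)[OF order_refl], of g] ident_services[OF assms]
  by simp

definition increment_char :: "real \<Rightarrow> complex" where
  "increment_char \<theta> = expectation (\<lambda>\<omega>. iexp (\<theta> * (real (a 1 \<omega>) - real (s 1 \<omega>))))"

lemma integrable_iexp_nat:
  assumes "1 \<le> k"
  shows "integrable M (\<lambda>\<omega>. iexp (\<theta> * real (q k \<omega>)))"
    "integrable M (\<lambda>\<omega>. iexp (\<theta> * real (a k \<omega>)))"
    "integrable M (\<lambda>\<omega>. iexp (\<theta> * real (s k \<omega>)))"
  using measurable_queue[OF assms] by (auto intro!: integrable_iexp simp flip: of_real_mult)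

text \<open>
  Before truncation at \<open>0\<close>, a time slot adds an increment that is independent of the queue
  length and whose law does not depend on the slot.
\<close>

lemma expectation_iexp_step:
  assumes "1 \<le> k"
  shows "expectation (\<lambda>\<omega>. iexp (\<theta> * (real (q k \<omega>) + (real (a k \<omega>) - real (s k \<omega>)))))
    = expectation (\<lambda>\<omega>. iexp (\<theta> * real (q k \<omega>))) * increment_char \<theta>"
proof -
  have split: "iexp (\<theta> * (real x + (real y - real z)))
      = iexp (\<theta> * real x) * iexp (\<theta> * real y) * iexp ((-\<theta>) * real z)" for x y z :: nat
    by (simp add: exp_add[symmetric] algebra_simps)
  have split0: "iexp (\<theta> * (real y - real z))
      = 1 * iexp (\<theta> * real y) * iexp ((-\<theta>) * real z)" for y z :: nat
    by (simp add: exp_add[symmetric] algebra_simps)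
  have "increment_char \<theta> = expectation (\<lambda>\<omega>. iexp (\<theta> * real (a 1 \<omega>)))
          * expectation (\<lambda>\<omega>. iexp ((-\<theta>) * real (s 1 \<omega>)))"
    unfolding increment_char_def split0
    using expectation_independent_product[OF order_refl _ integrable_iexp_nat(2,3)[OF order_refl],
        of "\<lambda>_. 1" \<theta> "-\<theta>"]
    by (simp add: prob_space del: of_real_mult of_real_minus)
  then show ?thesis
    unfolding split
    using expectation_independent_product[OF assms integrable_iexp_nat(1)[OF assms, of \<theta>]
        integrable_iexp_nat(2)[OF assms, of \<theta>] integrable_iexp_nat(3)[OF assms, of "-\<theta>"]]
      expectation_arrivals[OF assms, of "\<lambda>y. iexp (\<theta> * real y)"]
      expectation_services[OF assms, of "\<lambda>z. iexp ((-\<theta>) * real z)"]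
    by (simp del: of_real_mult of_real_minus add: mult.assoc)
qed

lemma integrable_arrivals_services:
  shows "integrable M (\<lambda>\<omega>. real (a 1 \<omega>))" and "integrable M (\<lambda>\<omega>. real (s 1 \<omega>))"
proof -
  note [measurable] = measurable_queue[OF order_refl]
  show "integrable M (\<lambda>\<omega>. real (a 1 \<omega>))"
    by (rule integrable_const_bound[where B = Amax])
      (use bounded_arrivals[OF order_refl] in simp, measurable)
  show "integrable M (\<lambda>\<omega>. real (s 1 \<omega>))"
    by (rule integrable_const_bound[where B = Smax])
      (use bounded_services[OF order_refl] in simp, measurable)
qed

text \<open>
  Independence removes the covariance, so this is the source of the sum of the two variances in
  the mean of the limit law.
\<close>

lemma second_moment_increment:
  "expectation (\<lambda>\<omega>. (real (a 1 \<omega>) - real (s 1 \<omega>))\<^sup>2)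
   = variance (\<lambda>\<omega>. real (a 1 \<omega>)) + variance (\<lambda>\<omega>. real (s 1 \<omega>))
     + (expectation (\<lambda>\<omega>. real (a 1 \<omega>)) - expectation (\<lambda>\<omega>. real (s 1 \<omega>)))\<^sup>2"
proof -
  note [measurable] = measurable_queue[OF order_refl] measurable_queue[OF order_refl, simplified]
  note a = integrable_arrivals_services(1) and s = integrable_arrivals_services(2)
  have a2: "integrable M (\<lambda>\<omega>. (real (a 1 \<omega>))\<^sup>2)"
  proof (rule integrable_const_bound[where B = "Amax\<^sup>2"])
    show "AE \<omega> in M. norm ((real (a 1 \<omega>))\<^sup>2) \<le> Amax\<^sup>2"
      using bounded_arrivals[of 1, simplified] by eventually_elim (auto intro: power_mono)
  qed simp
  have s2: "integrable M (\<lambda>\<omega>. (real (s 1 \<omega>))\<^sup>2)"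
  proof (rule integrable_const_bound[where B = "Smax\<^sup>2"])
    show "AE \<omega> in M. norm ((real (s 1 \<omega>))\<^sup>2) \<le> Smax\<^sup>2"
      using bounded_services[of 1, simplified] by eventually_elim (auto intro: power_mono)
  qed simp
  have as: "integrable M (\<lambda>\<omega>. real (a 1 \<omega>) * real (s 1 \<omega>))"
  proof (rule integrable_const_bound[where B = "Amax * Smax"])
    show "AE \<omega> in M. norm (real (a 1 \<omega>) * real (s 1 \<omega>)) \<le> Amax * Smax"
      using bounded_services[of 1, simplified] bounded_arrivals[of 1, simplified]
      by eventually_elim (auto intro!: mult_mono intro: order_trans[of 0 "real _"])
  qed simp
  have "expectation (\<lambda>\<omega>. real (a 1 \<omega>) * real (s 1 \<omega>))
      = expectation (\<lambda>\<omega>. real (a 1 \<omega>)) * expectation (\<lambda>\<omega>. real (s 1 \<omega>))"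
    using expectation_independent_product[of 1 "\<lambda>_. 1" real real] a s by (simp add: prob_space)
  then show ?thesis
    unfolding variance_eq[OF a a2] variance_eq[OF s s2]
    using a s a2 s2 as by (simp add: power2_diff mult.assoc)
qed

definition unused :: "nat \<Rightarrow> 'a \<Rightarrow> real" where
  "unused k \<omega> = real (q (k + 1) \<omega>) - (real (q k \<omega>) + (real (a k \<omega>) - real (s k \<omega>)))"

text \<open>
  The last claim is complementarity: service is wasted only if the queue ends up empty.
\<close>

lemma unused_bounds:
  assumes "1 \<le> k" "\<omega> \<in> space M"
  shows "0 \<le> unused k \<omega>" "unused k \<omega> \<le> real (s k \<omega>)"
    and "q (k + 1) \<omega> = 0 \<or> unused k \<omega> = 0"
  using dynamics[OF assms] by (auto simp: unused_def max_def split: if_splits)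

text \<open>
  Let \<open>u\<close> be the unused service and \<open>c\<close> the queue length before truncation, so the next queue length
  is \<open>q' = c + u\<close>. Since one of \<open>q'\<close> and \<open>u\<close> is \<open>0\<close>, the product of \<open>exp (\<i> \<theta> q') - 1\<close> and
  \<open>exp (- \<i> \<theta> u) - 1\<close> is \<open>0\<close>, that is,
  \<open>exp (\<i> \<theta> q') + exp (- \<i> \<theta> u) = exp (\<i> \<theta> c) + 1\<close>.
  Taking expectations expresses the left-hand side of the estimate through the law of \<open>u\<close>
  alone. There the linear term is exact and the error is at most \<open>\<theta>\<^sup>2 / 2\<close> times the second moment of
  \<open>u\<close>, which \<open>0 \<le> u \<le> Smax\<close> bounds by \<open>Smax\<close> times the mean.
\<close>

lemma one_step_estimate:
  assumes k: "1 \<le> k"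
  shows "expectation (unused k) \<in> {0..Smax}"
    and "cmod (expectation (\<lambda>\<omega>. iexp (\<theta> * real (q k \<omega>))) * increment_char \<theta>
           - expectation (\<lambda>\<omega>. iexp (\<theta> * real (q (k + 1) \<omega>))) + \<i> * \<theta> * expectation (unused k))
         \<le> \<theta>\<^sup>2 * Smax / 2 * expectation (unused k)"
proof -
  have k': "1 \<le> k + 1"
    by simp
  note [measurable] = measurable_queue[OF k] measurable_queue(1)[OF k']
  have [measurable]: "random_variable borel (unused k)"
    unfolding unused_def[abs_def] by measurable
  have le: "AE \<omega> in M. 0 \<le> unused k \<omega> \<and> unused k \<omega> \<le> Smax"
    using bounded_services[OF k] AE_space
    by eventually_elim (use unused_bounds[OF k] in force)
  have int: "integrable M (unused k)"
    by (rule integrable_const_bound[where B = Smax]) (use le in auto)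
  have int2: "integrable M (\<lambda>\<omega>. (unused k \<omega>)\<^sup>2)"
  proof (rule integrable_const_bound[where B = "Smax\<^sup>2"])
    show "AE \<omega> in M. norm ((unused k \<omega>)\<^sup>2) \<le> Smax\<^sup>2"
      using le by eventually_elim (auto intro: power_mono)
  qed simp
  have "expectation (unused k) \<le> expectation (\<lambda>_. Smax)"
    using le by (intro integral_mono_AE int) auto
  moreover have "0 \<le> expectation (unused k)"
    using le by (intro integral_nonneg_AE) auto
  ultimately show "expectation (unused k) \<in> {0..Smax}"
    by (simp add: prob_space)
  have int_iexp: "integrable M (\<lambda>\<omega>. iexp (c * X \<omega>))" if "random_variable borel X" for c X
    using integrable_iexp[of "\<lambda>\<omega>. complex_of_real (c * X \<omega>)"] that by simp
  have "expectation (\<lambda>\<omega>. iexp (\<theta> * real (q (k + 1) \<omega>)))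
          + expectation (\<lambda>\<omega>. iexp ((-\<theta>) * unused k \<omega>))
        = expectation (\<lambda>\<omega>. iexp (\<theta> * real (q (k + 1) \<omega>)) + iexp ((-\<theta>) * unused k \<omega>))"
    by (rule Bochner_Integration.integral_add[symmetric]; rule int_iexp) measurable
  also have "\<dots> = expectation (\<lambda>\<omega>. iexp (\<theta> * (real (q k \<omega>) + (real (a k \<omega>) - real (s k \<omega>)))) + 1)"
  proof (rule Bochner_Integration.integral_cong)
    fix \<omega> assume "\<omega> \<in> space M"
    then show "iexp (\<theta> * real (q (k + 1) \<omega>)) + iexp ((-\<theta>) * unused k \<omega>)
      = iexp (\<theta> * (real (q k \<omega>) + (real (a k \<omega>) - real (s k \<omega>)))) + 1"
    proof -
      define c where "c = real (q k \<omega>) + (real (a k \<omega>) - real (s k \<omega>))"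
      have "unused k \<omega> = real (q (k + 1) \<omega>) - c"
        by (simp add: unused_def c_def)
      then show ?thesis
        using unused_bounds(3)[OF k \<open>\<omega> \<in> space M\<close>] unfolding c_def[symmetric] by auto
    qed
  qed simp
  also have "\<dots> = expectation (\<lambda>\<omega>. iexp (\<theta> * (real (q k \<omega>) + (real (a k \<omega>) - real (s k \<omega>))))) + 1"
    by (subst Bochner_Integration.integral_add; (rule int_iexp)?; (measurable)?) (simp add: prob_space)
  finally have balance: "expectation (\<lambda>\<omega>. iexp (\<theta> * real (q k \<omega>))) * increment_char \<theta>
      - expectation (\<lambda>\<omega>. iexp (\<theta> * real (q (k + 1) \<omega>)))
      = expectation (\<lambda>\<omega>. iexp ((-\<theta>) * unused k \<omega>)) - 1"
    unfolding expectation_iexp_step[OF k] by (simp add: algebra_simps)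
  have "cmod (expectation (\<lambda>\<omega>. iexp ((-\<theta>) * unused k \<omega>)) - (1 + \<i> * (-\<theta>) * expectation (unused k)))
      \<le> \<theta>\<^sup>2 / 2 * expectation (\<lambda>\<omega>. (unused k \<omega>)\<^sup>2)"
  proof -
    have "AE \<omega> in M. \<bar>unused k \<omega>\<bar> \<le> Smax"
      using le by eventually_elim auto
    from iexp_expansion[OF _ this, of "-\<theta>" 1] show ?thesis
      by (simp add: prob_space flip: numeral_2_eq_2)
  qed
  also have "\<dots> \<le> \<theta>\<^sup>2 / 2 * expectation (\<lambda>\<omega>. Smax * unused k \<omega>)"
  proof (intro mult_left_mono integral_mono_AE int2)
    show "AE \<omega> in M. (unused k \<omega>)\<^sup>2 \<le> Smax * unused k \<omega>"
      using le by eventually_elim (auto simp: power2_eq_square intro: mult_right_mono)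
  qed (use int in auto)
  finally show "cmod (expectation (\<lambda>\<omega>. iexp (\<theta> * real (q k \<omega>))) * increment_char \<theta>
           - expectation (\<lambda>\<omega>. iexp (\<theta> * real (q (k + 1) \<omega>))) + \<i> * \<theta> * expectation (unused k))
         \<le> \<theta>\<^sup>2 * Smax / 2 * expectation (unused k)"
    unfolding balance by (simp add: algebra_simps)
qed

section \<open>The increment for small arguments\<close>

lemma increment_bounded: "AE \<omega> in M. \<bar>real (a 1 \<omega>) - real (s 1 \<omega>)\<bar> \<le> Amax + Smax"
proof -
  have "AE \<omega> in M. real (a 1 \<omega>) \<le> Amax" "AE \<omega> in M. real (s 1 \<omega>) \<le> Smax"
    using bounded_arrivals bounded_services by auto
  then show ?thesis
    by eventually_elim (use of_nat_0_le_iff in \<open>smt (verit)\<close>)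
qed

lemma expectation_increment:
  "expectation (\<lambda>\<omega>. real (a 1 \<omega>) - real (s 1 \<omega>))
   = expectation (\<lambda>\<omega>. real (a 1 \<omega>)) - expectation (\<lambda>\<omega>. real (s 1 \<omega>))"
  by (rule Bochner_Integration.integral_diff[OF integrable_arrivals_services])

text \<open>
  The first-order bound identifies the mean unused service; the second-order bound brings in the
  variances.
\<close>

lemma increment_char_expansion:
  defines "d \<equiv> expectation (\<lambda>\<omega>. real (a 1 \<omega>)) - expectation (\<lambda>\<omega>. real (s 1 \<omega>))"
  shows "cmod (increment_char \<theta> - 1 - \<i> * \<theta> * d) \<le> \<theta>\<^sup>2 / 2 * (Amax + Smax)\<^sup>2"
    and "cmod (increment_char \<theta> - 1 - \<i> * \<theta> * d
          + \<theta>\<^sup>2 / 2 * expectation (\<lambda>\<omega>. (real (a 1 \<omega>) - real (s 1 \<omega>))\<^sup>2))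
         \<le> \<bar>\<theta>\<bar> ^ 3 / 6 * (Amax + Smax) ^ 3"
proof -
  define X where "X \<omega> = real (a 1 \<omega>) - real (s 1 \<omega>)" for \<omega>
  note [measurable] = measurable_queue[OF order_refl]
  have X [measurable]: "random_variable borel X"
    unfolding X_def[abs_def] by measurable
  have B: "AE \<omega> in M. \<bar>X \<omega>\<bar> \<le> Amax + Smax"
    using increment_bounded by (simp add: X_def)
  have moment: "expectation (\<lambda>\<omega>. \<bar>X \<omega>\<bar> ^ n) \<le> (Amax + Smax) ^ n" for n
  proof -
    have le: "AE \<omega> in M. \<bar>X \<omega>\<bar> ^ n \<le> (Amax + Smax) ^ n"
      using B by eventually_elim (auto intro: power_mono)
    have "expectation (\<lambda>\<omega>. \<bar>X \<omega>\<bar> ^ n) \<le> expectation (\<lambda>_. (Amax + Smax) ^ n)"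
    proof (rule integral_mono_AE)
      show "integrable M (\<lambda>\<omega>. \<bar>X \<omega>\<bar> ^ n)"
        by (rule integrable_const_bound[where B = "(Amax + Smax) ^ n"]) (use le in auto)
    qed (use le in auto)
    then show ?thesis
      by (simp add: prob_space)
  qed
  have d: "expectation X = d"
    unfolding d_def using expectation_increment by (simp add: X_def[abs_def])
  have \<psi>: "increment_char \<theta> = expectation (\<lambda>\<omega>. iexp (\<theta> * X \<omega>))"
    by (simp add: increment_char_def X_def)
  have "cmod (increment_char \<theta> - (1 + \<i> * \<theta> * d)) \<le> \<theta>\<^sup>2 / 2 * expectation (\<lambda>\<omega>. \<bar>X \<omega>\<bar> ^ 2)"
    using iexp_expansion[OF X B, of \<theta> 1]
    by (simp add: prob_space d \<psi> flip: numeral_2_eq_2)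
  also have "\<dots> \<le> \<theta>\<^sup>2 / 2 * (Amax + Smax)\<^sup>2"
    using moment[of 2] by (intro mult_left_mono) auto
  finally show "cmod (increment_char \<theta> - 1 - \<i> * \<theta> * d) \<le> \<theta>\<^sup>2 / 2 * (Amax + Smax)\<^sup>2"
    by (simp add: diff_diff_eq)
  have "cmod (increment_char \<theta> - (1 + \<i> * \<theta> * d + (\<i> * \<theta>)\<^sup>2 / 2 * expectation (\<lambda>\<omega>. (X \<omega>)\<^sup>2)))
      \<le> \<bar>\<theta>\<bar> ^ 3 / 6 * expectation (\<lambda>\<omega>. \<bar>X \<omega>\<bar> ^ 3)"
  proof -
    have sum2: "(\<Sum>k\<le>2. f k) = f 0 + f 1 + f 2" for f :: "nat \<Rightarrow> complex"
      by (simp add: numeral_2_eq_2)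
    have "Suc 2 = 3" "fact 3 = (6 :: real)"
      by (simp_all add: fact_numeral)
    then show ?thesis
      using iexp_expansion[OF X B, of \<theta> 2] unfolding sum2
      by (simp add: prob_space d \<psi>)
  qed
  also have "\<dots> \<le> \<bar>\<theta>\<bar> ^ 3 / 6 * (Amax + Smax) ^ 3"
    using moment[of 3] by (intro mult_left_mono) auto
  finally show "cmod (increment_char \<theta> - 1 - \<i> * \<theta> * d
          + \<theta>\<^sup>2 / 2 * expectation (\<lambda>\<omega>. (real (a 1 \<omega>) - real (s 1 \<omega>))\<^sup>2))
         \<le> \<bar>\<theta>\<bar> ^ 3 / 6 * (Amax + Smax) ^ 3"
    by (simp add: X_def power_mult_distrib algebra_simps)
qed

section \<open>The steady state\<close>

text \<open>
  The one-step estimate passes to the limit \<open>k \<rightarrow> \<infinity>\<close> because both neighbouring characteristic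
  functions tend to that of the steady state. The mean unused service stays in a compact interval,
  hence has a limit point \<open>m'\<close>. Dividing the limiting estimate by \<open>\<theta>\<close> and letting \<open>\<theta>\<close> tend to \<open>0\<close>
  forces \<open>m'\<close> to be the drift \<open>m\<close>. This replaces the usual argument that the mean queue
  length is constant in the steady state, which would need a finite steady-state mean.
\<close>

lemma stationary_estimate:
  assumes Q: "real_distribution Q"
    and conv: "weak_conv_m (\<lambda>k. distr M borel (\<lambda>\<omega>. real (q k \<omega>))) Q"
  defines "m \<equiv> expectation (\<lambda>\<omega>. real (s 1 \<omega>)) - expectation (\<lambda>\<omega>. real (a 1 \<omega>))"
  shows "cmod (char Q \<theta> * (increment_char \<theta> - 1) + \<i> * \<theta> * m) \<le> \<theta>\<^sup>2 * Smax / 2 * m"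
proof -
  interpret Q: real_distribution Q by fact
  \<comment> \<open>The variable of index \<open>0\<close> need not be measurable, so the sequence is shifted by one.\<close>
  have rv: "(\<lambda>\<omega>. real (q (Suc k) \<omega>)) \<in> borel_measurable M" for k
    using measurable_queue(1)[of "Suc k"] by simp
  define \<phi> where "\<phi> k \<theta> = expectation (\<lambda>\<omega>. iexp (\<theta> * real (q (Suc k) \<omega>)))" for k \<theta>
  have char_k: "char (distr M borel (\<lambda>\<omega>. real (q (Suc k) \<omega>))) \<theta> = \<phi> k \<theta>" for k \<theta>
    unfolding char_def \<phi>_def by (subst integral_distr[OF rv]) simp_all
  have "weak_conv_m (\<lambda>k. distr M borel (\<lambda>\<omega>. real (q (Suc k) \<omega>))) Q"
    using conv unfolding weak_conv_m_def weak_conv_def by (auto intro: LIMSEQ_Suc)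
  from levy_continuity1[OF real_distribution_distr[OF rv] Q this]
  have \<phi>: "(\<lambda>k. \<phi> k \<theta>) \<longlonglongrightarrow> char Q \<theta>" for \<theta>
    by (simp add: char_k)
  define u where "u k = expectation (unused (Suc k))" for k
  have u: "u k \<in> {0..Smax}" for k
    unfolding u_def by (rule one_step_estimate(1)) simp
  then obtain m' r where r: "strict_mono r" "(u \<circ> r) \<longlonglongrightarrow> m'" and "m' \<in> {0..Smax}"
    using compact_Icc[of 0 Smax] unfolding compact_def by metis
  have est: "cmod (char Q \<theta> * (increment_char \<theta> - 1) + \<i> * \<theta> * m') \<le> \<theta>\<^sup>2 * Smax / 2 * m'" for \<theta>
  proof (rule LIMSEQ_le)
    have "(\<lambda>k. \<phi> (r k) \<theta>) \<longlonglongrightarrow> char Q \<theta>"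
      using LIMSEQ_subseq_LIMSEQ[OF \<phi> r(1)] by (simp add: comp_def)
    moreover have "(\<lambda>k. \<phi> (Suc (r k)) \<theta>) \<longlonglongrightarrow> char Q \<theta>"
      using LIMSEQ_subseq_LIMSEQ[OF LIMSEQ_Suc[OF \<phi>] r(1)] by (simp add: comp_def)
    moreover have ur: "(\<lambda>k. u (r k)) \<longlonglongrightarrow> m'"
      using r(2) by (simp add: comp_def)
    ultimately have "(\<lambda>k. cmod (\<phi> (r k) \<theta> * increment_char \<theta> - \<phi> (Suc (r k)) \<theta> + \<i> * \<theta> * u (r k)))
        \<longlonglongrightarrow> cmod (char Q \<theta> * increment_char \<theta> - char Q \<theta> + \<i> * \<theta> * m')"
      by (intro tendsto_intros)
    then show "(\<lambda>k. cmod (\<phi> (r k) \<theta> * increment_char \<theta> - \<phi> (Suc (r k)) \<theta> + \<i> * \<theta> * u (r k)))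
        \<longlonglongrightarrow> cmod (char Q \<theta> * (increment_char \<theta> - 1) + \<i> * \<theta> * m')"
      by (simp add: algebra_simps)
    show "(\<lambda>k. \<theta>\<^sup>2 * Smax / 2 * u (r k)) \<longlonglongrightarrow> \<theta>\<^sup>2 * Smax / 2 * m'"
      using ur by (intro tendsto_intros)
    show "\<exists>N. \<forall>n\<ge>N. cmod (\<phi> (r n) \<theta> * increment_char \<theta> - \<phi> (Suc (r n)) \<theta> + \<i> * \<theta> * u (r n))
        \<le> \<theta>\<^sup>2 * Smax / 2 * u (r n)"
      using one_step_estimate(2)[of "Suc (r n)" \<theta> for n] by (simp add: \<phi>_def u_def)
  qed
  have "m' = m"
  proof -
    let ?C = "(Amax + Smax)\<^sup>2 / 2 + Smax / 2 * m'"
    have "cmod (of_real m' - char Q \<theta> * m) \<le> \<theta> * ?C" if "0 < \<theta>" for \<theta> :: real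
    proof -
      let ?R = "increment_char \<theta> - 1 - \<i> * \<theta> * - m"
      have "cmod (char Q \<theta> * ?R) \<le> 1 * (\<theta>\<^sup>2 / 2 * (Amax + Smax)\<^sup>2)"
        unfolding norm_mult using increment_char_expansion(1)[of \<theta>]
        by (intro mult_mono Q.cmod_char_le_1) (simp_all add: m_def algebra_simps)
      moreover have remainder: "\<i> * \<theta> * (m' - char Q \<theta> * m)
          = (char Q \<theta> * (increment_char \<theta> - 1) + \<i> * \<theta> * m') - char Q \<theta> * ?R"
        by (simp add: algebra_simps)
      ultimately have "cmod (\<i> * \<theta> * (m' - char Q \<theta> * m))
          \<le> \<theta>\<^sup>2 * Smax / 2 * m' + 1 * (\<theta>\<^sup>2 / 2 * (Amax + Smax)\<^sup>2)"
        unfolding remainder using est[of \<theta>] norm_triangle_ineq4[of "char Q \<theta> * (increment_char \<theta> - 1) + \<i> * \<theta> * m'"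
            "char Q \<theta> * ?R"]
        by linarith
      also have "\<dots> = \<theta> * (\<theta> * ?C)"
        by (simp add: power2_eq_square field_simps)
      also have "cmod (\<i> * \<theta> * (m' - char Q \<theta> * m)) = \<theta> * cmod (m' - char Q \<theta> * m)"
        using that by (simp add: norm_mult)
      finally show ?thesis
        using that by simp
    qed
    then have "eventually (\<lambda>\<theta>. cmod (of_real m' - char Q \<theta> * m) \<le> \<theta> * ?C) (at_right 0)"
      by (intro eventually_at_rightI[of 0 1]) auto
    moreover have "(char Q \<longlongrightarrow> char Q 0) (at_right 0)"
      using Q.isCont_char[of 0] by (auto simp: isCont_def intro: tendsto_within_subset)
    then have "((\<lambda>\<theta>. cmod (of_real m' - char Q \<theta> * m)) \<longlongrightarrow> cmod (of_real m' - char Q 0 * m)) (at_right 0)"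
      by (intro tendsto_intros)
    moreover have "((\<lambda>\<theta>. \<theta> * ?C) \<longlongrightarrow> 0 * ?C) (at_right 0)"
      by (intro tendsto_intros)
    ultimately have "cmod (of_real m' - char Q 0 * m) \<le> 0 * ?C"
      by (intro tendsto_le[OF trivial_limit_at_right_real])
    then show "m' = m"
      by (simp add: Q.char_zero)
  qed
  with est show ?thesis
    by simp
qed

end

section \<open>The heavy-traffic limit\<close>

text \<open>
  Here \<open>\<psi> \<epsilon>\<close> and \<open>\<phi> \<epsilon>\<close> stand for the characteristic functions of the increment and of the steady state
  at \<open>\<epsilon> t\<close>, and \<open>v \<epsilon>\<close> for the second moment of the increment. The drift contributes \<open>\<epsilon> * (\<epsilon> t)\<close> and
  the second moment \<open>(\<epsilon> t)\<^sup>2 / 2\<close>, so both are of order \<open>\<epsilon>\<^sup>2\<close> while the errors are of order \<open>\<epsilon>\<^sup>3\<close>.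
  After division by \<open>\<epsilon>\<^sup>2\<close> the limit of \<open>\<phi>\<close> is a quotient with numerator \<open>\<i> t\<close> and denominator
  \<open>\<i> t + t\<^sup>2 V / 2\<close>, and \<open>t \<noteq> 0\<close> keeps the denominator away from \<open>0\<close> even if \<open>V = 0\<close>.
\<close>

lemma heavy_traffic_char_limit:
  fixes \<phi> \<psi> :: "real \<Rightarrow> complex" and v :: "real \<Rightarrow> real" and B S t V :: real
  assumes \<psi>: "eventually (\<lambda>\<epsilon>. cmod (\<psi> \<epsilon> - 1 + \<i> * (\<epsilon> * t) * \<epsilon> + (\<epsilon> * t)\<^sup>2 / 2 * v \<epsilon>)
      \<le> \<bar>\<epsilon> * t\<bar> ^ 3 * B) (at_right 0)"
    and \<phi>: "eventually (\<lambda>\<epsilon>. cmod (\<phi> \<epsilon> * (\<psi> \<epsilon> - 1) + \<i> * (\<epsilon> * t) * \<epsilon>)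
      \<le> (\<epsilon> * t)\<^sup>2 * S * \<epsilon>) (at_right 0)"
    and v: "(v \<longlongrightarrow> V) (at_right 0)" and "t \<noteq> 0"
  shows "(\<phi> \<longlongrightarrow> 1 / (1 - \<i> * t * (V / 2))) (at_right 0)"
proof -
  have pos: "eventually (\<lambda>\<epsilon>::real. 0 < \<epsilon>) (at_right 0)"
    by (rule eventually_at_right_less)
  define D where "D \<epsilon> = (1 - \<psi> \<epsilon>) / (\<epsilon>\<^sup>2 :: real)" for \<epsilon>
  have "((\<lambda>\<epsilon>. D \<epsilon> - (\<i> * t + t\<^sup>2 / 2 * v \<epsilon>)) \<longlongrightarrow> 0) (at_right 0)"
  proof (rule tendsto_0_le[where K = 1])
    show "((\<lambda>\<epsilon>. \<epsilon> * (\<bar>t\<bar> ^ 3 * B)) \<longlongrightarrow> 0) (at_right 0)"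
      by (auto intro!: tendsto_eq_intros)
    show "eventually (\<lambda>\<epsilon>. norm (D \<epsilon> - (\<i> * t + t\<^sup>2 / 2 * v \<epsilon>)) \<le> norm (\<epsilon> * (\<bar>t\<bar> ^ 3 * B)) * 1)
        (at_right 0)"
      using \<psi> pos
    proof eventually_elim
      case (elim \<epsilon>)
      have "\<epsilon>\<^sup>2 * norm (D \<epsilon> - (\<i> * t + t\<^sup>2 / 2 * v \<epsilon>)) = cmod (- (\<epsilon>\<^sup>2 * (D \<epsilon> - (\<i> * t + t\<^sup>2 / 2 * v \<epsilon>))))"
        by (simp add: norm_mult norm_power)
      also have "- (\<epsilon>\<^sup>2 * (D \<epsilon> - (\<i> * t + t\<^sup>2 / 2 * v \<epsilon>)))
          = \<psi> \<epsilon> - 1 + \<i> * (\<epsilon> * t) * \<epsilon> + (\<epsilon> * t)\<^sup>2 / 2 * v \<epsilon>"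
        using elim by (simp add: D_def field_simps power2_eq_square)
      also have "cmod \<dots> \<le> \<bar>\<epsilon> * t\<bar> ^ 3 * B"
        using elim by simp
      also have "\<dots> = \<epsilon>\<^sup>2 * (\<epsilon> * (\<bar>t\<bar> ^ 3 * B))"
        using elim by (simp add: abs_mult power_mult_distrib power2_eq_square power3_eq_cube)
      also have "\<dots> \<le> \<epsilon>\<^sup>2 * norm (\<epsilon> * (\<bar>t\<bar> ^ 3 * B))"
        by (intro mult_left_mono) auto
      finally show ?case
        using elim by simp
    qed
  qed
  moreover have "((\<lambda>\<epsilon>. \<i> * t + t\<^sup>2 / 2 * v \<epsilon>) \<longlongrightarrow> \<i> * t + t\<^sup>2 / 2 * V) (at_right 0)"
    using v by (intro tendsto_intros) auto
  ultimately have "((\<lambda>\<epsilon>. D \<epsilon> - (\<i> * t + t\<^sup>2 / 2 * v \<epsilon>) + (\<i> * t + t\<^sup>2 / 2 * v \<epsilon>))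
      \<longlongrightarrow> 0 + (\<i> * t + t\<^sup>2 / 2 * V)) (at_right 0)"
    by (rule tendsto_add)
  then have D: "(D \<longlongrightarrow> \<i> * t + t\<^sup>2 / 2 * V) (at_right 0)"
    by simp
  have "((\<lambda>\<epsilon>. \<phi> \<epsilon> * D \<epsilon> - \<i> * t) \<longlongrightarrow> 0) (at_right 0)"
  proof (rule tendsto_0_le[where K = 1])
    show "((\<lambda>\<epsilon>. \<epsilon> * (t\<^sup>2 * S)) \<longlongrightarrow> 0) (at_right 0)"
      by (auto intro!: tendsto_eq_intros)
    show "eventually (\<lambda>\<epsilon>. norm (\<phi> \<epsilon> * D \<epsilon> - \<i> * t) \<le> norm (\<epsilon> * (t\<^sup>2 * S)) * 1) (at_right 0)"
      using \<phi> pos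
    proof eventually_elim
      case (elim \<epsilon>)
      have "\<epsilon>\<^sup>2 * norm (\<phi> \<epsilon> * D \<epsilon> - \<i> * t) = cmod (- (\<epsilon>\<^sup>2 * (\<phi> \<epsilon> * D \<epsilon> - \<i> * t)))"
        by (simp add: norm_mult norm_power)
      also have "- (\<epsilon>\<^sup>2 * (\<phi> \<epsilon> * D \<epsilon> - \<i> * t)) = \<phi> \<epsilon> * (\<psi> \<epsilon> - 1) + \<i> * (\<epsilon> * t) * \<epsilon>"
        using elim by (simp add: D_def field_simps power2_eq_square)
      also have "cmod \<dots> \<le> (\<epsilon> * t)\<^sup>2 * S * \<epsilon>"
        using elim by simp
      also have "\<dots> = \<epsilon>\<^sup>2 * (\<epsilon> * (t\<^sup>2 * S))"
        by (simp add: power_mult_distrib)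
      also have "\<dots> \<le> \<epsilon>\<^sup>2 * norm (\<epsilon> * (t\<^sup>2 * S))"
        by (intro mult_left_mono) auto
      finally show ?case
        using elim by simp
    qed
  qed
  then have N: "((\<lambda>\<epsilon>. \<phi> \<epsilon> * D \<epsilon>) \<longlongrightarrow> \<i> * t) (at_right 0)"
    by (simp add: LIM_zero_iff)
  have nz: "\<i> * t + t\<^sup>2 / 2 * V \<noteq> 0"
    using \<open>t \<noteq> 0\<close> by (simp add: complex_eq_iff)
  have "((\<lambda>\<epsilon>. \<phi> \<epsilon> * D \<epsilon> / D \<epsilon>) \<longlongrightarrow> \<i> * t / (\<i> * t + t\<^sup>2 / 2 * V)) (at_right 0)"
    by (rule tendsto_divide[OF N D nz])
  moreover have "eventually (\<lambda>\<epsilon>. \<phi> \<epsilon> * D \<epsilon> / D \<epsilon> = \<phi> \<epsilon>) (at_right 0)"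
    using tendsto_imp_eventually_ne[OF D nz] by eventually_elim simp
  moreover have "\<i> * t / (\<i> * t + t\<^sup>2 / 2 * V) = 1 / (1 - \<i> * t * (V / 2))"
  proof -
    have "\<i> * t + t\<^sup>2 / 2 * V = \<i> * t * (1 - \<i> * t * (V / 2))"
      by (simp add: algebra_simps power2_eq_square)
    then show ?thesis
      using \<open>t \<noteq> 0\<close> by simp
  qed
  ultimately show ?thesis
    using Lim_transform_eventually by fastforce
qed

theorem theorem1:
  fixes M :: "'a measure" and N :: "real \<Rightarrow> 'b measure"
    and a q :: "real \<Rightarrow> nat \<Rightarrow> 'a \<Rightarrow> nat" and s :: "nat \<Rightarrow> 'a \<Rightarrow> nat"
    and qbar :: "real \<Rightarrow> 'b \<Rightarrow> real"
    and \<sigma>\<^sub>a\<^sub>\<epsilon> :: "real \<Rightarrow> real" and \<mu> \<sigma>\<^sub>a \<sigma>\<^sub>s Amax Smax :: real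
  assumes "0 < \<mu>"
    and queue: "\<And>\<epsilon>. \<epsilon> \<in> {0<..<\<mu>} \<Longrightarrow> single_server_queue M (a \<epsilon>) s (q \<epsilon>) Amax Smax"
    and service_mean: "prob_space.expectation M (\<lambda>\<omega>. real (s 1 \<omega>)) = \<mu>"
    and service_variance: "prob_space.variance M (\<lambda>\<omega>. real (s 1 \<omega>)) = \<sigma>\<^sub>s\<^sup>2"
    and arrival_mean: "\<And>\<epsilon>. \<epsilon> \<in> {0<..<\<mu>} \<Longrightarrow>
      prob_space.expectation M (\<lambda>\<omega>. real (a \<epsilon> 1 \<omega>)) = \<mu> - \<epsilon>"
    and arrival_variance: "\<And>\<epsilon>. \<epsilon> \<in> {0<..<\<mu>} \<Longrightarrow>
      prob_space.variance M (\<lambda>\<omega>. real (a \<epsilon> 1 \<omega>)) = (\<sigma>\<^sub>a\<^sub>\<epsilon> \<epsilon>)\<^sup>2"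
    and steady_state_space: "\<And>\<epsilon>. \<epsilon> \<in> {0<..<\<mu>} \<Longrightarrow> prob_space (N \<epsilon>)"
    and steady_state_rv: "\<And>\<epsilon>. \<epsilon> \<in> {0<..<\<mu>} \<Longrightarrow> qbar \<epsilon> \<in> borel_measurable (N \<epsilon>)"
    and steady_state_limit: "\<And>\<epsilon>. \<epsilon> \<in> {0<..<\<mu>} \<Longrightarrow>
      weak_conv_m (\<lambda>k. distr M borel (\<lambda>\<omega>. real (q \<epsilon> k \<omega>))) (distr (N \<epsilon>) borel (qbar \<epsilon>))"
    and arrival_sd_limit: "(\<sigma>\<^sub>a\<^sub>\<epsilon> \<longlongrightarrow> \<sigma>\<^sub>a) (at_right 0)"
  shows "weak_conv_along (at_right 0)
    (\<lambda>\<epsilon>. distr (N \<epsilon>) borel (\<lambda>\<omega>. \<epsilon> * qbar \<epsilon> \<omega>))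
    (exponential_law ((\<sigma>\<^sub>a\<^sup>2 + \<sigma>\<^sub>s\<^sup>2) / 2))"
proof (rule weak_conv_along_at_right_if_char[OF \<open>0 < \<mu>\<close>])
  fix \<epsilon> assume "\<epsilon> \<in> {0<..<\<mu>}"
  then show "real_distribution (distr (N \<epsilon>) borel (\<lambda>\<omega>. \<epsilon> * qbar \<epsilon> \<omega>))"
    using steady_state_space steady_state_rv
    by (intro prob_space.real_distribution_distr) auto
next
  show "real_distribution (exponential_law ((\<sigma>\<^sub>a\<^sup>2 + \<sigma>\<^sub>s\<^sup>2) / 2))"
    by (rule real_distribution_exponential_law) simp
next
  fix t :: real
  define Q where "Q \<epsilon> = distr (N \<epsilon>) borel (qbar \<epsilon>)" for \<epsilon>
  define \<psi> where "\<psi> \<epsilon> = single_server_queue.increment_char M (a \<epsilon>) s (\<epsilon> * t)" for \<epsilon>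
  define v where "v \<epsilon> = (\<sigma>\<^sub>a\<^sub>\<epsilon> \<epsilon>)\<^sup>2 + \<sigma>\<^sub>s\<^sup>2 + \<epsilon>\<^sup>2" for \<epsilon>
  have small: "eventually (\<lambda>\<epsilon>. \<epsilon> \<in> {0<..<\<mu>}) (at_right 0)"
    using \<open>0 < \<mu>\<close> by (rule eventually_at_right_real)
  have estimates: "char (distr (N \<epsilon>) borel (\<lambda>\<omega>. \<epsilon> * qbar \<epsilon> \<omega>)) t = char (Q \<epsilon>) (\<epsilon> * t)"
    "real_distribution (Q \<epsilon>)"
    "cmod (\<psi> \<epsilon> - 1 + \<i> * (\<epsilon> * t) * \<epsilon> + (\<epsilon> * t)\<^sup>2 / 2 * v \<epsilon>)
      \<le> \<bar>\<epsilon> * t\<bar> ^ 3 * ((Amax + Smax) ^ 3 / 6)"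
    "cmod (char (Q \<epsilon>) (\<epsilon> * t) * (\<psi> \<epsilon> - 1) + \<i> * (\<epsilon> * t) * \<epsilon>) \<le> (\<epsilon> * t)\<^sup>2 * (Smax / 2) * \<epsilon>"
    if \<epsilon>: "\<epsilon> \<in> {0<..<\<mu>}" for \<epsilon>
  proof -
    interpret queue: single_server_queue M "a \<epsilon>" s "q \<epsilon>" Amax Smax
      by (rule queue[OF \<epsilon>])
    note [measurable] = steady_state_rv[OF \<epsilon>]
    show "char (distr (N \<epsilon>) borel (\<lambda>\<omega>. \<epsilon> * qbar \<epsilon> \<omega>)) t = char (Q \<epsilon>) (\<epsilon> * t)"
      unfolding Q_def char_def by (subst (1 2) integral_distr) (simp_all add: ac_simps)
    show Q: "real_distribution (Q \<epsilon>)"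
      unfolding Q_def using steady_state_space[OF \<epsilon>]
      by (intro prob_space.real_distribution_distr) auto
    have "queue.expectation (\<lambda>\<omega>. (real (a \<epsilon> 1 \<omega>) - real (s 1 \<omega>))\<^sup>2) = v \<epsilon>"
      unfolding queue.second_moment_increment
      unfolding arrival_variance[OF \<epsilon>] service_variance
      unfolding arrival_mean[OF \<epsilon>] service_mean by (simp add: v_def)
    then show "cmod (\<psi> \<epsilon> - 1 + \<i> * (\<epsilon> * t) * \<epsilon> + (\<epsilon> * t)\<^sup>2 / 2 * v \<epsilon>)
        \<le> \<bar>\<epsilon> * t\<bar> ^ 3 * ((Amax + Smax) ^ 3 / 6)"
      using queue.increment_char_expansion(2)[of "\<epsilon> * t"]
      unfolding arrival_mean[OF \<epsilon>] service_mean \<psi>_def by (simp add: algebra_simps)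
    show "cmod (char (Q \<epsilon>) (\<epsilon> * t) * (\<psi> \<epsilon> - 1) + \<i> * (\<epsilon> * t) * \<epsilon>) \<le> (\<epsilon> * t)\<^sup>2 * (Smax / 2) * \<epsilon>"
      using queue.stationary_estimate[OF Q steady_state_limit[OF \<epsilon>, folded Q_def], of "\<epsilon> * t"]
      unfolding arrival_mean[OF \<epsilon>] service_mean \<psi>_def by simp
  qed
  have "((\<lambda>\<epsilon>. char (Q \<epsilon>) (\<epsilon> * t)) \<longlongrightarrow> 1 / (1 - \<i> * t * ((\<sigma>\<^sub>a\<^sup>2 + \<sigma>\<^sub>s\<^sup>2) / 2))) (at_right 0)"
  proof (cases "t = 0")
    case True
    have "eventually (\<lambda>\<epsilon>. char (Q \<epsilon>) (\<epsilon> * t) = 1) (at_right 0)"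
      using small by eventually_elim (simp add: True real_distribution.char_zero estimates(2))
    then show ?thesis
      using True by (simp add: tendsto_eventually)
  next
    case False
    have v: "(v \<longlongrightarrow> \<sigma>\<^sub>a\<^sup>2 + \<sigma>\<^sub>s\<^sup>2) (at_right 0)"
      unfolding v_def[abs_def] using arrival_sd_limit by (auto intro!: tendsto_eq_intros)
    show ?thesis
      by (rule heavy_traffic_char_limit[where v = v, OF eventually_mono[OF small estimates(3)]
            eventually_mono[OF small estimates(4)] v False])
  qed
  then have "((\<lambda>\<epsilon>. char (Q \<epsilon>) (\<epsilon> * t)) \<longlongrightarrow> char (exponential_law ((\<sigma>\<^sub>a\<^sup>2 + \<sigma>\<^sub>s\<^sup>2) / 2)) t) (at_right 0)"
    by (simp add: char_exponential_law)
  then show "((\<lambda>\<epsilon>. char (distr (N \<epsilon>) borel (\<lambda>\<omega>. \<epsilon> * qbar \<epsilon> \<omega>)) t)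
      \<longlongrightarrow> char (exponential_law ((\<sigma>\<^sub>a\<^sup>2 + \<sigma>\<^sub>s\<^sup>2) / 2)) t) (at_right 0)"
    by (rule Lim_transform_eventually) (use small estimates(1) in \<open>auto elim: eventually_mono\<close>)
qed

end
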